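(* Let $n,p\ge 1$ and $1\le s\le p$ be integers, $\delta\ge 0$, let $X,\Xi$ be $n\times p$ real matrices, $Z=X+\Xi$ with $|\Xi|_\infty\le\delta$, let $y\in\mathbb{R}^n$, and let $\Theta\subseteq\mathbb{R}^p$ be a convex set. Assume that there exists an $s$-sparse vector $\theta_s\in\Theta$ with $y=X\theta_s$. Let $\hat\theta$ be any solution of the minimization problem $$\min\{|\theta|_1 : \theta\in\Theta,\ |y-Z\theta|_\infty\le\delta|\theta|_1\}.$$ Then the following hold. (i) $\displaystyle \frac1n|X(\hat\theta-\theta_s)|_2^2\le 4\delta^2|\hat\theta|_1^2.$ (ii) If Assumption RE($s$) holds with constant $\kappa>0$, then $\displaystyle |\hat\theta-\theta_s|_1\le\frac{4\sqrt{s}\,\delta}{\kappa}|\hat\theta|_1.$ (iii) If Assumption RE($2s$) holds with constant $\kappa>0$, then $\displaystyle |\hat\theta-\theta_s|_2\le\frac{4\delta}{\kappa}|\hat\theta|_1.$ (iv) If Assumption C holds with $\rho<\frac{1}{3\alpha s}$ for some $\alpha>1$, then $$|\hat\theta-\theta_s|_\infty< 2\Big(1+\frac{2}{3\sqrt{s\alpha(\alpha-1)}}\Big)\delta|\hat\theta|_1.$$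
   Context: For a vector $x$, $|x|_q$ ($q\ge1$) is its $\ell_q$-norm and $|x|_\infty$ the maximum absolute value of its components; for a matrix, $|\cdot|_\infty$ is the maximum absolute value of its entries. A vector is $s$-sparse if it has at most $s$ nonzero components. For $\theta\in\mathbb{R}^p$ and $J\subseteq\{1,\dots,p\}$, $\theta_J\in\mathbb{R}^p$ has the same coordinates as $\theta$ on $J$ and zero coordinates on the complement $J^c$. Assumption RE($s$) (on $X$) with constant $\kappa>0$: for all $J\subseteq\{1,\dots,p\}$ with $|J|\le s$ and all $\Delta\in\mathbb{R}^p$, $\Delta\neq0$, with $|\Delta_{J^c}|_1\le|\Delta_J|_1$, one has $\frac{|X\Delta|_2}{\sqrt n\,|\Delta_J|_2}\ge\kappa$ (if $\Delta_J=0$ there is no such $\Delta$). RE($2s$) is the same with $|J|\le 2s$. Assumption C (on $X$) with parameter $\rho<1$: all diagonal elements of $\Psi=X^TX/n$ equal $1$, and the off-diagonal elements satisfy $\max_{i\ne j}|\Psi_{ij}|\le\rho$.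
   Formalization: In (iv) the strict inequality fails when δ = 0 or θ̂ = 0, as the right side is then 0; the formal statement proves (iv) with ≤ in all cases and with the strict < whenever δ ≠ 0 and θ̂ ≠ 0. *)

theory Defs
  imports "HOL-Analysis.Analysis"
begin

text \<open>
  An \<open>n \<times> p\<close> matrix is an element of \<open>real ^ 'p ^ 'n\<close>, with \<open>n = CARD('n)\<close> and \<open>p = CARD('p)\<close>.
  For vectors, the Euclidean norm is \<^const>\<open>norm\<close> and the maximum norm is \<^const>\<open>infnorm\<close>.
\<close>

definition l1norm :: "real ^ 'p \<Rightarrow> real" where
  "l1norm x = (\<Sum>i\<in>UNIV. \<bar>x $ i\<bar>)"

definition entry_maxnorm :: "real ^ 'p ^ 'n \<Rightarrow> real" where
  "entry_maxnorm A = Max (range (\<lambda>(i, j). \<bar>A $ i $ j\<bar>))"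

definition s_sparse :: "nat \<Rightarrow> real ^ 'p \<Rightarrow> bool" where
  "s_sparse s x \<longleftrightarrow> card {i. x $ i \<noteq> 0} \<le> s"

definition restr :: "'p set \<Rightarrow> real ^ 'p \<Rightarrow> real ^ 'p" where
  "restr J x = (\<chi> i. if i \<in> J then x $ i else 0)"

text \<open>
  In the quotient below the denominator is nonzero: if \<open>restr J \<Delta> = 0\<close>, then the cone condition
  forces \<open>\<Delta> = 0\<close>.
\<close>

definition assumption_RE :: "nat \<Rightarrow> real \<Rightarrow> real ^ 'p ^ 'n \<Rightarrow> bool" where
  "assumption_RE s \<kappa> X \<longleftrightarrow> \<kappa> > 0 \<and>
     (\<forall>J \<Delta>. card J \<le> s \<longrightarrow> \<Delta> \<noteq> 0 \<longrightarrow> l1norm (restr (- J) \<Delta>) \<le> l1norm (restr J \<Delta>) \<longrightarrow>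
        norm (X *v \<Delta>) / (sqrt (real CARD('n)) * norm (restr J \<Delta>)) \<ge> \<kappa>)"

definition gram :: "real ^ 'p ^ 'n \<Rightarrow> real ^ 'p ^ 'p" where
  "gram X = (1 / real CARD('n)) *\<^sub>R (transpose X ** X)"

definition assumption_C :: "real \<Rightarrow> real ^ 'p ^ 'n \<Rightarrow> bool" where
  "assumption_C \<rho> X \<longleftrightarrow> \<rho> < 1 \<and> (\<forall>i. gram X $ i $ i = 1) \<and>
     (\<forall>i j. i \<noteq> j \<longrightarrow> \<bar>gram X $ i $ j\<bar> \<le> \<rho>)"

definition is_solution ::
  "real \<Rightarrow> (real ^ 'p) set \<Rightarrow> real ^ 'n \<Rightarrow> real ^ 'p ^ 'n \<Rightarrow> real ^ 'p \<Rightarrow> bool" where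
  "is_solution \<delta> \<Theta> y Z =
     is_arg_min l1norm (\<lambda>\<theta>. \<theta> \<in> \<Theta> \<and> infnorm (y - Z *v \<theta>) \<le> \<delta> * l1norm \<theta>)"

end

theory Submission
  imports Defs
begin

text \<open>
  Write \<open>\<Delta> = \<theta>h - \<theta>\<^sub>s\<close> and \<open>J\<close> for the support of \<open>\<theta>\<^sub>s\<close>. Since \<open>y - Z \<theta>\<^sub>s = - \<Xi> \<theta>\<^sub>s\<close>, the vector
  \<open>\<theta>\<^sub>s\<close> is feasible, so \<open>|\<theta>h|\<^sub>1 \<le> |\<theta>\<^sub>s|\<^sub>1\<close>, which puts \<open>\<Delta>\<close> in the cone \<open>|\<Delta>\<^bsub>- J\<^esub>|\<^sub>1 \<le> |\<Delta>\<^bsub>J\<^esub>|\<^sub>1\<close>; and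
  \<open>X \<Delta> = (Z \<theta>h - y) - \<Xi> \<theta>h\<close> has all entries at most \<open>2 \<delta> |\<theta>h|\<^sub>1\<close>. This gives (i), and (ii)
  after the Cauchy--Schwarz inequality on \<open>J\<close>. For (iii), enlarge \<open>J\<close> by the \<open>s\<close> largest remaining
  coordinates of \<open>\<Delta>\<close>; the tail then has Euclidean norm at most \<open>|\<Delta>\<^bsub>- J\<^esub>|\<^sub>1 / sqrt s\<close>. For (iv), low
  coherence implies RE(\<open>s\<close>) with \<open>\<kappa>\<^sup>2 = 1 - 1 / \<alpha>\<close>, and \<open>\<Delta> = \<Psi> \<Delta> - (\<Psi> - 1) \<Delta>\<close> is
  estimated coordinatewise using (i) and (ii).
\<close>

section \<open>Norms of vectors and their restrictions\<close>

lemma l1norm_nonneg: "0 \<le> l1norm x"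
  unfolding l1norm_def by (simp add: sum_nonneg)

lemma l1norm_eq_0_iff: "l1norm x = 0 \<longleftrightarrow> x = 0"
  unfolding l1norm_def by (simp add: sum_nonneg_eq_0_iff vec_eq_iff)

lemma l1norm_restr: "l1norm (restr J x) = (\<Sum>i\<in>J. \<bar>x $ i\<bar>)"
proof -
  have "l1norm (restr J x) = (\<Sum>i\<in>UNIV. if i \<in> J then \<bar>x $ i\<bar> else 0)"
    unfolding l1norm_def restr_def by (intro sum.cong) auto
  then show ?thesis by (simp add: sum.If_cases)
qed

lemma norm_restr_squared: "(norm (restr J x))\<^sup>2 = (\<Sum>i\<in>J. (x $ i)\<^sup>2)"
proof -
  have "(norm (restr J x))\<^sup>2 = (\<Sum>i\<in>UNIV. if i \<in> J then (x $ i)\<^sup>2 else 0)"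
    unfolding power2_norm_eq_inner inner_vec_def restr_def
    by (intro sum.cong) (auto simp: power2_eq_square)
  then show ?thesis by (simp add: sum.If_cases)
qed

lemma restr_add_compl: "restr J x + restr (- J) x = x"
  unfolding restr_def vec_eq_iff by simp

lemma inner_restr_compl: "restr J x \<bullet> restr (- J) y = 0"
  unfolding restr_def inner_vec_def by (intro sum.neutral) simp

lemma l1norm_split: "l1norm x = l1norm (restr J x) + l1norm (restr (- J) x)"
  unfolding l1norm_restr unfolding l1norm_def
  by (metis Compl_eq_Diff_UNIV finite subset_UNIV sum.subset_diff add.commute)

lemma l1norm_restr_mono: "J \<subseteq> K \<Longrightarrow> l1norm (restr J x) \<le> l1norm (restr K x)"
  unfolding l1norm_restr by (intro sum_mono2) auto

lemma norm_restr_mono: "J \<subseteq> K \<Longrightarrow> norm (restr J x) \<le> norm (restr K x)"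
  by (rule power2_le_imp_le) (auto simp: norm_restr_squared intro!: sum_mono2)

lemma l1norm_restr_le_norm:
  assumes "card J \<le> s"
  shows "l1norm (restr J x) \<le> sqrt (real s) * norm (restr J x)"
proof (rule power2_le_imp_le)
  have "(l1norm (restr J x))\<^sup>2 \<le> real (card J) * (\<Sum>i\<in>J. \<bar>x $ i\<bar>\<^sup>2)"
    using Cauchy_Schwarz_ineq_sum[of "\<lambda>_. 1" "\<lambda>i. \<bar>x $ i\<bar>" J] by (simp add: l1norm_restr)
  also have "\<dots> \<le> real s * (\<Sum>i\<in>J. \<bar>x $ i\<bar>\<^sup>2)"
    using assms by (intro mult_right_mono sum_nonneg) auto
  finally show "(l1norm (restr J x))\<^sup>2 \<le> (sqrt (real s) * norm (restr J x))\<^sup>2"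
    by (simp add: power_mult_distrib norm_restr_squared)
qed simp

lemma infnorm_le_iff:
  fixes x :: "real ^ 'n"
  shows "infnorm x \<le> c \<longleftrightarrow> (\<forall>i. \<bar>x $ i\<bar> \<le> c)"
proof
  show "infnorm x \<le> c \<Longrightarrow> \<forall>i. \<bar>x $ i\<bar> \<le> c"
    using component_le_infnorm_cart order_trans by blast
  show "\<forall>i. \<bar>x $ i\<bar> \<le> c \<Longrightarrow> infnorm x \<le> c"
    unfolding infnorm_cart by (intro cSup_least) auto
qed

lemma norm_le_sqrt_card_mult:
  fixes x :: "real ^ 'n"
  assumes "\<And>i. \<bar>x $ i\<bar> \<le> c"
  shows "norm x \<le> sqrt (real CARD('n)) * c"
proof (rule power2_le_imp_le)
  have "(x $ i)\<^sup>2 \<le> c\<^sup>2" for i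
    using assms[of i] abs_le_square_iff[of "x $ i" c] by linarith
  then have "(\<Sum>i\<in>UNIV. (x $ i)\<^sup>2) \<le> (\<Sum>i\<in>(UNIV::'n set). c\<^sup>2)"
    by (intro sum_mono)
  then show "(norm x)\<^sup>2 \<le> (sqrt (real CARD('n)) * c)\<^sup>2"
    by (simp add: power_mult_distrib power2_norm_eq_inner inner_vec_def flip: power2_eq_square)
  have "0 \<le> c" using assms[of undefined] by linarith
  then show "0 \<le> sqrt (real CARD('n)) * c" by simp
qed

text \<open>Hoelder's inequality for the exponents 1 and infinity.\<close>

lemma abs_inner_le_l1norm:
  fixes u w :: "real ^ 'p"
  assumes "\<And>i. \<bar>w $ i\<bar> \<le> c"
  shows "\<bar>u \<bullet> w\<bar> \<le> c * l1norm u"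
proof -
  have "\<bar>u \<bullet> w\<bar> \<le> (\<Sum>i\<in>UNIV. \<bar>u $ i * w $ i\<bar>)"
    unfolding inner_vec_def by simp
  also have "\<dots> \<le> (\<Sum>i\<in>UNIV. c * \<bar>u $ i\<bar>)"
    using assms by (intro sum_mono) (simp add: abs_mult mult.commute[of c] mult_left_mono)
  finally show ?thesis by (simp add: l1norm_def sum_distrib_left)
qed

lemma matrix_vector_mult_component_le:
  fixes A :: "real ^ 'p ^ 'n"
  assumes "\<And>i j. \<bar>A $ i $ j\<bar> \<le> c"
  shows "\<bar>(A *v x) $ i\<bar> \<le> c * l1norm x"
  using abs_inner_le_l1norm[of "A $ i" c x] assms
  by (simp add: matrix_vector_mul_component inner_commute)

lemma component_le_entry_maxnorm: "\<bar>A $ i $ j\<bar> \<le> entry_maxnorm A"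
  unfolding entry_maxnorm_def by (rule Max_ge) (auto intro: rev_image_eqI[of "(i, j)"])

text \<open>Off \<open>J\<close> the difference is just \<open>b\<close>. Whatever mass
  \<open>b\<close> has there must be made up on \<open>J\<close>, where by the triangle inequality
  \<open>b\<close> falls short of \<open>a\<close> by at most the mass of
  \<open>b - a\<close>.\<close>

lemma cone_of_l1norm_le:
  fixes a b :: "real ^ 'p"
  assumes "l1norm b \<le> l1norm a" and "{i. a $ i \<noteq> 0} \<subseteq> J"
  shows "l1norm (restr (- J) (b - a)) \<le> l1norm (restr J (b - a))"
proof -
  have off: "restr (- J) a = 0" "restr (- J) (b - a) = restr (- J) b"
    using assms(2) by (auto simp: restr_def vec_eq_iff)
  have "l1norm (restr J a) \<le> l1norm (restr J b) + l1norm (restr J (b - a))"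
    unfolding l1norm_restr sum.distrib[symmetric] by (intro sum_mono) auto
  then show ?thesis
    using assms(1) l1norm_split[of a J] l1norm_split[of b J] l1norm_eq_0_iff[of "restr (- J) a"]
    by (simp add: off)
qed

section \<open>Restricted eigenvalues\<close>

text \<open>The division-free form also covers \<open>restr J \<Delta> = 0\<close>, where it is
  trivial.\<close>

lemma assumption_RE_D:
  fixes X :: "real ^ 'p ^ 'n"
  assumes "assumption_RE s \<kappa> X" and "card J \<le> s"
    and "l1norm (restr (- J) \<Delta>) \<le> l1norm (restr J \<Delta>)"
  shows "sqrt (real CARD('n)) * (\<kappa> * norm (restr J \<Delta>)) \<le> norm (X *v \<Delta>)"
proof (cases "norm (restr J \<Delta>) = 0")
  case False
  then have "\<Delta> \<noteq> 0" by (auto simp: restr_def zero_vec_def)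
  then have "\<kappa> \<le> norm (X *v \<Delta>) / (sqrt (real CARD('n)) * norm (restr J \<Delta>))"
    using assms unfolding assumption_RE_def by blast
  with False show ?thesis by (simp add: pos_le_divide_eq mult.left_commute)
qed simp

lemma exists_top_subset:
  fixes f :: "'a \<Rightarrow> 'b::linorder"
  assumes "finite A" and "k \<le> card A"
  shows "\<exists>B\<subseteq>A. card B = k \<and> (\<forall>a\<in>A - B. \<forall>b\<in>B. f a \<le> f b)"
  using assms(2)
proof (induction k)
  case 0
  then show ?case by (intro exI[of _ "{}"]) simp
next
  case (Suc k)
  then obtain B where B: "B \<subseteq> A" "card B = k" "\<forall>a\<in>A - B. \<forall>b\<in>B. f a \<le> f b"
    by auto
  have fB: "finite B" using B(1) assms(1) finite_subset by blast
  have "A - B \<noteq> {}"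
    using Suc.prems B fB by (metis Diff_eq_empty_iff card_mono not_less_eq_eq)
  \<comment> \<open>Greedy choice: a maximiser of \<open>f\<close> among the remaining elements
    joins \<open>B\<close>.\<close>
  then have "Max (f ` (A - B)) \<in> f ` (A - B)"
    using assms(1) by (intro Max_in) auto
  then obtain m where m: "m \<in> A - B" "f m = Max (f ` (A - B))"
    by auto
  have "f a \<le> f m" if "a \<in> A - B" for a
    using that assms(1) unfolding m(2) by (intro Max_ge) auto
  then show ?case
    using B m fB by (intro exI[of _ "insert m B"]) auto
qed

text \<open>An entry outside \<open>B\<close> is at most each of the \<open>s\<close> entries in
  \<open>B\<close>, so \<open>s\<close> copies of it are bounded by the l1-norm on \<open>A\<close>.
  Replacing one factor of each square by this bound leaves another l1-norm.\<close>

lemma norm_restr_tail_le: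
  fixes x :: "real ^ 'p"
  assumes "B \<subseteq> A" and "card B = s" and "1 \<le> s"
    and top: "\<And>a b. a \<in> A - B \<Longrightarrow> b \<in> B \<Longrightarrow> \<bar>x $ a\<bar> \<le> \<bar>x $ b\<bar>"
  shows "sqrt (real s) * norm (restr (A - B) x) \<le> l1norm (restr A x)"
proof (rule power2_le_imp_le)
  have s: "0 < real s" using assms(3) by simp
  have ent: "real s * \<bar>x $ a\<bar> \<le> l1norm (restr A x)" if "a \<in> A - B" for a
  proof -
    have "real s * \<bar>x $ a\<bar> = (\<Sum>b\<in>B. \<bar>x $ a\<bar>)" using assms(2) by simp
    also have "\<dots> \<le> l1norm (restr B x)"
      unfolding l1norm_restr using that top by (intro sum_mono) auto
    also have "\<dots> \<le> l1norm (restr A x)" using assms(1) by (rule l1norm_restr_mono)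
    finally show ?thesis .
  qed
  have "real s * (\<Sum>a\<in>A - B. (x $ a)\<^sup>2) = (\<Sum>a\<in>A - B. (real s * \<bar>x $ a\<bar>) * \<bar>x $ a\<bar>)"
    by (simp add: sum_distrib_left power2_eq_square mult.assoc)
  also have "\<dots> \<le> (\<Sum>a\<in>A - B. l1norm (restr A x) * \<bar>x $ a\<bar>)"
    using ent by (intro sum_mono mult_right_mono) auto
  also have "\<dots> = l1norm (restr A x) * l1norm (restr (A - B) x)"
    by (simp add: sum_distrib_left l1norm_restr)
  also have "\<dots> \<le> (l1norm (restr A x))\<^sup>2"
    unfolding power2_eq_square
    by (intro mult_left_mono l1norm_restr_mono l1norm_nonneg) auto
  finally show "(sqrt (real s) * norm (restr (A - B) x))\<^sup>2 \<le> (l1norm (restr A x))\<^sup>2"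
    by (simp add: power_mult_distrib norm_restr_squared)
qed (rule l1norm_nonneg)

lemma cone_norm_le_double_restr:
  fixes x :: "real ^ 'p"
  assumes "card J \<le> s" and "1 \<le> s"
    and cone: "l1norm (restr (- J) x) \<le> l1norm (restr J x)"
  obtains K where "J \<subseteq> K" and "card K \<le> 2 * s" and "norm x \<le> 2 * norm (restr K x)"
proof (cases "s \<le> card (- J)")
  \<comment> \<open>Fewer than \<open>s\<close> coordinates remain outside \<open>J\<close>, so
    \<open>K\<close> can be the whole index set.\<close>
  case False
  then have "card (UNIV :: 'p set) \<le> 2 * s"
    using assms(1) card_Un_le[of J "- J"] by simp
  moreover have "restr UNIV x = x" by (simp add: restr_def vec_eq_iff)
  ultimately show thesis using that[of UNIV] by simp
next
  case True
  then obtain B where B: "B \<subseteq> - J" "card B = s"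
      "\<forall>a\<in>- J - B. \<forall>b\<in>B. \<bar>x $ a\<bar> \<le> \<bar>x $ b\<bar>"
    using exists_top_subset[of "- J" s "\<lambda>i. \<bar>x $ i\<bar>"] by auto
  let ?K = "J \<union> B"
  have compl: "- J - B = - ?K" by auto
  have "sqrt (real s) * norm (restr (- ?K) x) \<le> l1norm (restr (- J) x)"
    using norm_restr_tail_le[of B "- J" s x] B assms(2) by (auto simp: compl)
  also have "\<dots> \<le> sqrt (real s) * norm (restr J x)"
    using cone l1norm_restr_le_norm[OF assms(1), of x] by linarith
  \<comment> \<open>The factor \<open>sqrt s\<close> lost by Cauchy-Schwarz on \<open>J\<close>
    cancels the one gained on the tail.\<close>
  finally have "norm (restr (- ?K) x) \<le> norm (restr J x)"
    using assms(2) by simp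
  moreover have "norm (restr J x) \<le> norm (restr ?K x)" by (rule norm_restr_mono) simp
  moreover have "norm x \<le> norm (restr ?K x) + norm (restr (- ?K) x)"
    by (metis norm_triangle_ineq restr_add_compl)
  moreover have "card ?K \<le> 2 * s" using card_Un_le[of J B] B(2) assms(1) by linarith
  ultimately show thesis using that[of ?K] by simp
qed

text \<open>The eigenvalue bound is assumed only for this \<open>J\<close> and \<Delta>, so that it
  can come either from RE or from coherence.\<close>

lemma cone_l1norm_le_of_norm_restr:
  fixes X :: "real ^ 'p ^ 'n"
  assumes "card J \<le> s" and "l1norm (restr (- J) \<Delta>) \<le> l1norm (restr J \<Delta>)" and "0 < \<kappa>"
    and "sqrt (real CARD('n)) * (\<kappa> * norm (restr J \<Delta>)) \<le> norm (X *v \<Delta>)"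
    and "norm (X *v \<Delta>) \<le> sqrt (real CARD('n)) * c"
  shows "l1norm \<Delta> \<le> 2 * sqrt (real s) * c / \<kappa>"
proof -
  have "sqrt (real CARD('n)) * (\<kappa> * norm (restr J \<Delta>)) \<le> sqrt (real CARD('n)) * c"
    using assms(4,5) by (rule order_trans)
  then have "norm (restr J \<Delta>) \<le> c / \<kappa>"
    using assms(3) by (simp add: pos_le_divide_eq mult.commute)
  then have "sqrt (real s) * norm (restr J \<Delta>) \<le> sqrt (real s) * (c / \<kappa>)"
    by (intro mult_left_mono) auto
  then show ?thesis
    using l1norm_split[of \<Delta> J] assms(2) l1norm_restr_le_norm[OF assms(1), of \<Delta>] by simp
qed

section \<open>Mutual coherence\<close>

lemma inner_matrix_vector_mult_gram:
  fixes X :: "real ^ 'p ^ 'n"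
  shows "(X *v u) \<bullet> (X *v v) = real CARD('n) * (u \<bullet> (gram X *v v))"
proof -
  have "(X *v u) \<bullet> (X *v v) = u \<bullet> (transpose X *v (X *v v))"
    by (metis dot_lmul_matrix inner_commute transpose_matrix_vector)
  moreover have "gram X *v v = (1 / real CARD('n)) *\<^sub>R (transpose X *v (X *v v))"
    unfolding gram_def by (simp add: scaleR_matrix_vector_assoc matrix_vector_mul_assoc)
  ultimately show ?thesis by simp
qed

text \<open>Component \<open>i\<close> is the inner product of column \<open>i\<close> of
  \<open>X\<close> with \<open>X *v v\<close>, divided by \<open>n\<close>. The unit diagonal says
  that this column has norm \<open>sqrt n\<close>, and Cauchy-Schwarz finishes.\<close>

lemma gram_mult_component_le:
  fixes X :: "real ^ 'p ^ 'n"
  assumes "gram X $ i $ i = 1" and "norm (X *v v) \<le> sqrt (real CARD('n)) * c"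
  shows "\<bar>(gram X *v v) $ i\<bar> \<le> c"
proof -
  let ?n = "real CARD('n)" and ?e = "axis i (1::real)"
  have "(X *v ?e) \<bullet> (X *v ?e) = ?n"
    unfolding inner_matrix_vector_mult_gram using assms(1)
    by (simp add: inner_axis' matrix_vector_mult_basis column_def)
  then have col: "norm (X *v ?e) = sqrt ?n" by (simp add: norm_eq_sqrt_inner)
  have "?n * \<bar>(gram X *v v) $ i\<bar> = \<bar>(X *v ?e) \<bullet> (X *v v)\<bar>"
    unfolding inner_matrix_vector_mult_gram by (simp add: inner_axis' abs_mult)
  also have "\<dots> \<le> sqrt ?n * norm (X *v v)"
    using Cauchy_Schwarz_ineq2[of "X *v ?e" "X *v v"] by (simp add: col)
  also have "\<dots> \<le> sqrt ?n * (sqrt ?n * c)"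
    using assms(2) by (intro mult_left_mono) auto
  also have "\<dots> = ?n * c" by (simp flip: mult.assoc)
  finally show ?thesis by simp
qed

lemma gram_eq_id_plus_offdiagonal:
  fixes X :: "real ^ 'p ^ 'n"
  assumes "assumption_C \<rho> X" and "0 \<le> \<rho>"
  obtains W where "\<And>v. gram X *v v = v + W *v v" and "\<And>i j. \<bar>W $ i $ j\<bar> \<le> \<rho>"
proof
  let ?W = "gram X - mat 1"
  show "gram X *v v = v + ?W *v v" for v
    by (simp add: matrix_vector_mult_diff_rdistrib)
  show "\<bar>?W $ i $ j\<bar> \<le> \<rho>" for i j
    using assms unfolding assumption_C_def by (auto simp: mat_def)
qed

text \<open>
  The term \<open>|X \<Delta>\<^bsub>- J\<^esub>|\<^sub>2\<^sup>2\<close> is discarded before the off-diagonal part is estimated; this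
  gives the factor 3 rather than 4.
\<close>

lemma coherence_restricted_eigenvalue:
  fixes X :: "real ^ 'p ^ 'n"
  assumes "assumption_C \<rho> X" and "0 \<le> \<rho>" and "card J \<le> s"
    and cone: "l1norm (restr (- J) \<Delta>) \<le> l1norm (restr J \<Delta>)"
  shows "(1 - 3 * \<rho> * real s) * (real CARD('n) * (norm (restr J \<Delta>))\<^sup>2) \<le> (norm (X *v \<Delta>))\<^sup>2"
proof -
  let ?n = "real CARD('n)"
  define a b where "a = restr J \<Delta>" and "b = restr (- J) \<Delta>"
  obtain W where W: "\<And>v. gram X *v v = v + W *v v" "\<And>i j. \<bar>W $ i $ j\<bar> \<le> \<rho>"
    using gram_eq_id_plus_offdiagonal[OF assms(1,2)] by blast
  \<comment> \<open>The bound on \<open>v\<close> is chosen to fit both \<open>v = a\<close> and, by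
    the cone condition, \<open>v = b\<close>.\<close>
  have off: "- (\<rho> * (l1norm a)\<^sup>2) \<le> a \<bullet> (W *v v)" if "l1norm v \<le> l1norm a" for v
  proof -
    have "\<bar>a \<bullet> (W *v v)\<bar> \<le> \<rho> * l1norm v * l1norm a"
      using matrix_vector_mult_component_le[OF W(2)] by (rule abs_inner_le_l1norm)
    also have "\<dots> \<le> \<rho> * (l1norm a)\<^sup>2"
      unfolding power2_eq_square mult.assoc
      using that assms(2) by (intro mult_left_mono mult_right_mono l1norm_nonneg)
    finally show ?thesis by linarith
  qed
  have "(l1norm a)\<^sup>2 \<le> (sqrt (real s) * norm a)\<^sup>2"
    using l1norm_restr_le_norm[OF assms(3), of \<Delta>] l1norm_nonneg
    unfolding a_def by (rule power_mono)
  then have "\<rho> * (l1norm a)\<^sup>2 \<le> \<rho> * (real s * (norm a)\<^sup>2)"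
    using assms(2) by (simp add: power_mult_distrib mult_left_mono)
  then have "(1 - 3 * \<rho> * real s) * (norm a)\<^sup>2 \<le> (norm a)\<^sup>2 - 3 * (\<rho> * (l1norm a)\<^sup>2)"
    by (simp add: algebra_simps)
  \<comment> \<open>Since \<open>a\<close> and \<open>b\<close> are orthogonal, only
    \<open>W\<close> contributes to the cross term. The three losses are one from \<open>a\<close>
    with itself and two from the doubled cross term.\<close>
  also have "\<dots> \<le> a \<bullet> (gram X *v a) + 2 * (a \<bullet> (gram X *v b))"
    using off[of a] off[of b] cone inner_restr_compl[of J \<Delta> \<Delta>]
    by (simp add: W(1) inner_add_right power2_norm_eq_inner flip: a_def b_def)
  finally have "?n * ((1 - 3 * \<rho> * real s) * (norm a)\<^sup>2)
      \<le> ?n * (a \<bullet> (gram X *v a) + 2 * (a \<bullet> (gram X *v b)))"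
    by (intro mult_left_mono) auto
  also have "\<dots> = (X *v a) \<bullet> (X *v a) + 2 * ((X *v a) \<bullet> (X *v b))"
    by (simp add: inner_matrix_vector_mult_gram algebra_simps)
  also have "\<dots> \<le> (norm (X *v a + X *v b))\<^sup>2"
    by (simp add: power2_norm_eq_inner inner_add_left inner_add_right inner_commute)
  also have "X *v a + X *v b = X *v \<Delta>"
    unfolding a_def b_def by (metis matrix_vector_right_distrib restr_add_compl)
  finally show ?thesis by (simp add: a_def mult.left_commute)
qed

lemma coherence_norm_restr_le:
  fixes X :: "real ^ 'p ^ 'n"
  assumes "assumption_C \<rho> X" and "0 \<le> \<rho>" and "card J \<le> s" and "1 \<le> s" and "1 < \<alpha>"
    and "\<rho> < 1 / (3 * \<alpha> * real s)"
    and cone: "l1norm (restr (- J) \<Delta>) \<le> l1norm (restr J \<Delta>)"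
  shows "sqrt (real CARD('n)) * (sqrt (1 - 1 / \<alpha>) * norm (restr J \<Delta>)) \<le> norm (X *v \<Delta>)"
proof (rule power2_le_imp_le)
  have "3 * \<rho> * real s \<le> 1 / \<alpha>"
    using assms(4-6) by (simp add: field_simps)
  then have "(1 - 1 / \<alpha>) * (real CARD('n) * (norm (restr J \<Delta>))\<^sup>2)
      \<le> (1 - 3 * \<rho> * real s) * (real CARD('n) * (norm (restr J \<Delta>))\<^sup>2)"
    by (intro mult_right_mono) auto
  also have "\<dots> \<le> (norm (X *v \<Delta>))\<^sup>2"
    using assms(1-3) cone by (rule coherence_restricted_eigenvalue)
  finally show "(sqrt (real CARD('n)) * (sqrt (1 - 1 / \<alpha>) * norm (restr J \<Delta>)))\<^sup>2
      \<le> (norm (X *v \<Delta>))\<^sup>2"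
    using assms(5) by (simp add: power_mult_distrib mult.left_commute)
qed simp

text \<open>The left side is the bound on \<rho> times the l1 bound with \<kappa> =
  \<open>sqrt (1 - 1 / \<alpha>)\<close>. Naming the roots of \<alpha>, \<open>\<alpha> - 1\<close>
  and \<open>s\<close> turns the identity into one of rational functions.\<close>

lemma coherence_constant:
  fixes \<alpha> s :: real
  assumes "1 < \<alpha>" and "0 < s"
  shows "1 / (3 * \<alpha> * s) * (2 * sqrt s * c / sqrt (1 - 1 / \<alpha>))
    = c * (2 / (3 * sqrt (s * \<alpha> * (\<alpha> - 1))))"
proof -
  define a b t where "a = sqrt \<alpha>" and "b = sqrt (\<alpha> - 1)" and "t = sqrt s"
  have pos: "0 < a" "0 < b" "0 < t" using assms by (auto simp: a_def b_def t_def)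
  have "sqrt (1 - 1 / \<alpha>) = sqrt ((\<alpha> - 1) / \<alpha>)"
    using assms(1) by (simp add: diff_divide_distrib)
  also have "\<dots> = b / a" by (simp add: a_def b_def real_sqrt_divide)
  finally have "sqrt (1 - 1 / \<alpha>) = b / a" .
  moreover have "sqrt (s * \<alpha> * (\<alpha> - 1)) = t * a * b"
    by (simp add: a_def b_def t_def real_sqrt_mult)
  moreover have "a\<^sup>2 = \<alpha>" "t\<^sup>2 = s" using assms by (auto simp: a_def t_def)
  moreover have "1 / (3 * a\<^sup>2 * t\<^sup>2) * (2 * t * c / (b / a)) = c * (2 / (3 * (t * a * b)))"
    using pos by (simp add: field_simps power2_eq_square)
  ultimately show ?thesis by (simp only: flip: t_def)
qed

text \<open>The diagonal of the Gram matrix accounts for the summand 1, its off-diagonal part for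
  the fraction. Strictness comes from the strict bound on \<rho>, which survives multiplication by
  the l1 bound \<open>M\<close> only if \<open>M\<close> is positive; hence the second claim asks
  for \<open>0 < c\<close>.\<close>

lemma coherence_infnorm_le:
  fixes X :: "real ^ 'p ^ 'n"
  assumes C: "assumption_C \<rho> X" and "card J \<le> s" and "1 \<le> s" and \<alpha>: "1 < \<alpha>"
    and \<rho>: "\<rho> < 1 / (3 * \<alpha> * real s)"
    and cone: "l1norm (restr (- J) \<Delta>) \<le> l1norm (restr J \<Delta>)"
    and c: "norm (X *v \<Delta>) \<le> sqrt (real CARD('n)) * c"
  shows "infnorm \<Delta> \<le> (1 + 2 / (3 * sqrt (real s * \<alpha> * (\<alpha> - 1)))) * c"
    and "0 < c \<Longrightarrow> infnorm \<Delta> < (1 + 2 / (3 * sqrt (real s * \<alpha> * (\<alpha> - 1)))) * c"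
proof -
  \<comment> \<open>for \<open>p = 1\<close> the parameter \<open>\<rho>\<close> may be negative\<close>
  define r where "r = max \<rho> 0"
  define M where "M = 2 * sqrt (real s) * c / sqrt (1 - 1 / \<alpha>)"
  have r: "0 \<le> r" "r < 1 / (3 * \<alpha> * real s)" using \<rho> \<alpha> assms(3) by (auto simp: r_def)
  have Cr: "assumption_C r X" using C unfolding assumption_C_def r_def by fastforce
  obtain W where W: "\<And>v. gram X *v v = v + W *v v" "\<And>i j. \<bar>W $ i $ j\<bar> \<le> r"
    using gram_eq_id_plus_offdiagonal[OF Cr r(1)] by blast
  have "\<bar>\<Delta> $ i\<bar> \<le> c + r * l1norm \<Delta>" for i
  proof -
    have "\<Delta> $ i = (gram X *v \<Delta>) $ i - (W *v \<Delta>) $ i" by (simp add: W(1))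
    moreover have "\<bar>(gram X *v \<Delta>) $ i\<bar> \<le> c"
      using C c by (intro gram_mult_component_le) (auto simp: assumption_C_def)
    moreover have "\<bar>(W *v \<Delta>) $ i\<bar> \<le> r * l1norm \<Delta>"
      using W(2) by (rule matrix_vector_mult_component_le)
    ultimately show ?thesis by linarith
  qed
  then have inf: "infnorm \<Delta> \<le> c + r * l1norm \<Delta>" by (simp add: infnorm_le_iff)
  have "l1norm \<Delta> \<le> M"
    unfolding M_def using assms(2) cone _ _ c
    by (rule cone_l1norm_le_of_norm_restr)
      (use \<alpha> coherence_norm_restr_le[OF Cr r(1) assms(2,3) \<alpha> r(2) cone] in auto)
  then have inf: "infnorm \<Delta> \<le> c + r * M" and M: "0 \<le> M"
    using inf mult_left_mono[OF _ r(1), of "l1norm \<Delta>" M] l1norm_nonneg[of \<Delta>] by linarith+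
  have rhs: "c + 1 / (3 * \<alpha> * real s) * M = (1 + 2 / (3 * sqrt (real s * \<alpha> * (\<alpha> - 1)))) * c"
    unfolding M_def using coherence_constant[OF \<alpha>, of "real s" c] assms(3)
    by (simp add: algebra_simps)
  show "infnorm \<Delta> \<le> (1 + 2 / (3 * sqrt (real s * \<alpha> * (\<alpha> - 1)))) * c"
    using inf mult_right_mono[OF less_imp_le[OF r(2)] M] rhs by linarith
  assume "0 < c"
  then have "0 < M" using \<alpha> assms(3) by (simp add: M_def)
  then show "infnorm \<Delta> < (1 + 2 / (3 * sqrt (real s * \<alpha> * (\<alpha> - 1)))) * c"
    using inf mult_strict_right_mono[OF r(2)] rhs by fastforce
qed

section \<open>The estimator\<close>

text \<open>In the last claim the right side vanishes when \<delta> or \<open>\<theta>h\<close> is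
  zero, so strict inequality is impossible there; the non-strict bound covers that case.\<close>

theorem theorem1:
  fixes X \<Xi> Z :: "real ^ 'p ^ 'n"
    and y :: "real ^ 'n"
    and \<Theta> :: "(real ^ 'p) set"
    and \<theta>\<^sub>s \<theta>h :: "real ^ 'p"
    and \<delta> :: real
    and s :: nat
  assumes "1 \<le> s" and "s \<le> CARD('p)"
    and "0 \<le> \<delta>"
    and "Z = X + \<Xi>"
    and "entry_maxnorm \<Xi> \<le> \<delta>"
    and "convex \<Theta>"
    and "\<theta>\<^sub>s \<in> \<Theta>" and "s_sparse s \<theta>\<^sub>s" and "y = X *v \<theta>\<^sub>s"
    and "is_solution \<delta> \<Theta> y Z \<theta>h"
  shows
    "(1 / real CARD('n)) * (norm (X *v (\<theta>h - \<theta>\<^sub>s)))\<^sup>2 \<le> 4 * \<delta>\<^sup>2 * (l1norm \<theta>h)\<^sup>2 \<and>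
     (\<forall>\<kappa>. assumption_RE s \<kappa> X \<longrightarrow>
        l1norm (\<theta>h - \<theta>\<^sub>s) \<le> (4 * sqrt (real s) * \<delta> / \<kappa>) * l1norm \<theta>h) \<and>
     (\<forall>\<kappa>. assumption_RE (2 * s) \<kappa> X \<longrightarrow>
        norm (\<theta>h - \<theta>\<^sub>s) \<le> (4 * \<delta> / \<kappa>) * l1norm \<theta>h) \<and>
     (\<forall>\<rho> \<alpha>. assumption_C \<rho> X \<longrightarrow> \<alpha> > 1 \<longrightarrow> \<rho> < 1 / (3 * \<alpha> * real s) \<longrightarrow>
        infnorm (\<theta>h - \<theta>\<^sub>s)
          \<le> 2 * (1 + 2 / (3 * sqrt (real s * \<alpha> * (\<alpha> - 1)))) * \<delta> * l1norm \<theta>h \<and>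
        (\<delta> \<noteq> 0 \<and> \<theta>h \<noteq> 0 \<longrightarrow>
         infnorm (\<theta>h - \<theta>\<^sub>s)
          < 2 * (1 + 2 / (3 * sqrt (real s * \<alpha> * (\<alpha> - 1)))) * \<delta> * l1norm \<theta>h))"
proof -
  define \<Delta> where "\<Delta> = \<theta>h - \<theta>\<^sub>s"
  define L where "L = l1norm \<theta>h"
  define J where "J = {i. \<theta>\<^sub>s $ i \<noteq> 0}"
  have L: "0 \<le> L" by (simp add: L_def l1norm_nonneg)
  have J: "card J \<le> s" using assms(8) by (simp add: s_sparse_def J_def)
  have noise: "\<bar>(\<Xi> *v \<theta>) $ i\<bar> \<le> \<delta> * l1norm \<theta>" for \<theta> i
    using component_le_entry_maxnorm order_trans[OF _ assms(5)]
    by (intro matrix_vector_mult_component_le) blast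
  have sol: "infnorm (y - Z *v \<theta>h) \<le> \<delta> * L"
      "\<theta> \<in> \<Theta> \<Longrightarrow> infnorm (y - Z *v \<theta>) \<le> \<delta> * l1norm \<theta> \<Longrightarrow> L \<le> l1norm \<theta>" for \<theta>
    using assms(10) unfolding is_solution_def is_arg_min_linorder L_def by auto
  have "infnorm (y - Z *v \<theta>\<^sub>s) \<le> \<delta> * l1norm \<theta>\<^sub>s"
    using noise[of \<theta>\<^sub>s]
    by (simp add: infnorm_le_iff assms(4,9) matrix_vector_mult_add_rdistrib)
  then have "l1norm \<theta>h \<le> l1norm \<theta>\<^sub>s" using sol(2) assms(7) by (simp add: L_def)
  then have cone: "l1norm (restr (- J) \<Delta>) \<le> l1norm (restr J \<Delta>)"
    unfolding \<Delta>_def by (rule cone_of_l1norm_le) (simp add: J_def)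
  have "\<bar>(X *v \<Delta>) $ i\<bar> \<le> 2 * \<delta> * L" for i
  proof -
    have "(X *v \<Delta>) $ i = - (y - Z *v \<theta>h) $ i - (\<Xi> *v \<theta>h) $ i"
      by (simp add: \<Delta>_def assms(4,9) matrix_vector_mult_add_rdistrib matrix_vector_mult_diff_distrib)
    then show ?thesis
      using sol(1)[unfolded infnorm_le_iff, rule_format, of i] noise[of \<theta>h i] unfolding L_def by simp
  qed
  \<comment> \<open>The constant \<open>2 * \<delta> * L\<close> is the \<open>c\<close> of the
    earlier lemmas; the 4 in the second and third claims is this 2 times the 2 lost in passing from
    a restriction to all of \<Delta>.\<close>
  then have fit: "norm (X *v \<Delta>) \<le> sqrt (real CARD('n)) * (2 * \<delta> * L)"
    by (rule norm_le_sqrt_card_mult)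
  have i: "(1 / real CARD('n)) * (norm (X *v \<Delta>))\<^sup>2 \<le> 4 * \<delta>\<^sup>2 * L\<^sup>2"
    using power_mono[OF fit norm_ge_zero, of 2] by (simp add: power_mult_distrib field_simps)
  have ii: "l1norm \<Delta> \<le> (4 * sqrt (real s) * \<delta> / \<kappa>) * L" if "assumption_RE s \<kappa> X" for \<kappa>
    using cone_l1norm_le_of_norm_restr[OF J cone _ assumption_RE_D[OF that J cone] fit] that
    by (simp add: assumption_RE_def mult_ac)
  have iii: "norm \<Delta> \<le> (4 * \<delta> / \<kappa>) * L" if RE: "assumption_RE (2 * s) \<kappa> X" for \<kappa>
  proof -
    have \<kappa>: "0 < \<kappa>" using RE by (simp add: assumption_RE_def)
    obtain K where K: "J \<subseteq> K" "card K \<le> 2 * s" "norm \<Delta> \<le> 2 * norm (restr K \<Delta>)"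
      using cone_norm_le_double_restr[OF J assms(1) cone] .
    \<comment> \<open>Enlarging \<open>J\<close> to \<open>K\<close> preserves the cone condition:
      its left side shrinks and its right side grows.\<close>
    have "l1norm (restr (- K) \<Delta>) \<le> l1norm (restr (- J) \<Delta>)"
      using K(1) by (intro l1norm_restr_mono) auto
    moreover have "l1norm (restr J \<Delta>) \<le> l1norm (restr K \<Delta>)"
      using K(1) by (rule l1norm_restr_mono)
    ultimately have "l1norm (restr (- K) \<Delta>) \<le> l1norm (restr K \<Delta>)" using cone by linarith
    from order_trans[OF assumption_RE_D[OF RE K(2) this] fit]
    have "sqrt (real CARD('n)) * (\<kappa> * norm (restr K \<Delta>)) \<le> sqrt (real CARD('n)) * (2 * \<delta> * L)" .
    then have "norm (restr K \<Delta>) \<le> 2 * \<delta> * L / \<kappa>"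
      using \<kappa> by (simp add: pos_le_divide_eq mult.commute)
    with K(3) show ?thesis by simp
  qed
  have iv: "infnorm \<Delta> \<le> 2 * (1 + 2 / (3 * sqrt (real s * \<alpha> * (\<alpha> - 1)))) * \<delta> * L \<and>
      (\<delta> \<noteq> 0 \<and> \<theta>h \<noteq> 0 \<longrightarrow>
        infnorm \<Delta> < 2 * (1 + 2 / (3 * sqrt (real s * \<alpha> * (\<alpha> - 1)))) * \<delta> * L)"
    if "assumption_C \<rho> X" "1 < \<alpha>" "\<rho> < 1 / (3 * \<alpha> * real s)" for \<rho> \<alpha>
  proof -
    have "0 < 2 * \<delta> * L" if "\<delta> \<noteq> 0 \<and> \<theta>h \<noteq> 0"
      using that assms(3) L l1norm_eq_0_iff[of \<theta>h] by (auto simp: L_def)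
    with coherence_infnorm_le[OF that(1) J assms(1) that(2,3) cone fit]
    show ?thesis by (simp add: mult_ac)
  qed
  show ?thesis
    using i ii iii iv unfolding \<Delta>_def L_def by blast
qed

end
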